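(* Let $k\ge 1$ be an integer and $|q|<1$. Then $$\sum_{n_1,\dots,n_k\ge 0}\frac{q^{N_1^2+N_2^2+\cdots+N_k^2+2N_k}\,(-q;q^2)_{n_k}}{(q^2;q^2)_{n_1}(q^2;q^2)_{n_2}\cdots(q^2;q^2)_{n_{k-1}}\,(q^4;q^4)_{n_k}} =\frac{(-q;q^2)_\infty}{(q^2;q^2)_\infty}\,(q^{2k+4},q^k,q^{k+4};q^{2k+4})_\infty =\frac{(q^2;q^4)_\infty}{(q;q)_\infty}\,(q^{2k+4},q^k,q^{k+4};q^{2k+4})_\infty ,$$ where the sum is over all $k$-tuples $(n_1,\dots,n_k)$ of nonnegative integers and $N_i=n_i+n_{i+1}+\cdots+n_k$ for $i=1,\dots,k$.
   Context: Notation: $(a;q)_n=\prod_{j=0}^{n-1}(1-aq^j)$, $(a;q)_\infty=\prod_{j=0}^\infty(1-aq^j)$ for $|q|<1$, and $(a_1,a_2,\dots,a_m;q)_\infty=(a_1;q)_\infty(a_2;q)_\infty\cdots(a_m;q)_\infty$. For $k=1$ the denominator on the left is just $(q^4;q^4)_{n_1}$. *)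

theory Defs
  imports "HOL-Analysis.Analysis"
begin

definition qpoch :: "complex \<Rightarrow> complex \<Rightarrow> nat \<Rightarrow> complex" where
  "qpoch a q n = (\<Prod>j<n. 1 - a * q ^ j)"

text \<open>Meaningful for \<open>norm q < 1\<close>, where the product converges
  (to zero if one of its factors vanishes).\<close>

definition qpoch_inf :: "complex \<Rightarrow> complex \<Rightarrow> complex" where
  "qpoch_inf a q = (\<Prod>j. 1 - a * q ^ j)"

definition qpoch_inf_list :: "complex list \<Rightarrow> complex \<Rightarrow> complex" where
  "qpoch_inf_list as q = (\<Prod>a\<leftarrow>as. qpoch_inf a q)"

definition tail_sum :: "nat \<Rightarrow> (nat \<Rightarrow> nat) \<Rightarrow> nat \<Rightarrow> nat" where
  "tail_sum k n i = (\<Sum>j=i..k. n j)"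

end

theory Submission
  imports Defs
begin

text \<open>
  Put \<open>Q = q\<^sup>2\<close>. Slater's Bailey pair E(4) relative to 1, in base \<open>Q\<close>, is
  \<open>\<beta> L = Q ^ L / (Q\<^sup>2;Q\<^sup>2)\<^sub>L\<close>, and its bilateral \<open>\<alpha> r\<close> is \<open>(-1) ^ r * Q ^ (r\<^sup>2 - r)\<close>. The Bailey lemma with one
  parameter sent to infinity and the other equal to \<open>-q\<close> replaces \<open>\<alpha> r\<close> by \<open>q ^ r\<^sup>2 * \<alpha> r\<close> and
  \<open>\<gamma> L = (-q;Q)\<^sub>L * \<beta> L\<close> by the sum over \<open>r\<close> of \<open>q ^ r\<^sup>2 * \<gamma> r / (Q;Q)\<^sub>L\<^sub>-\<^sub>r\<close>. After \<open>k\<close> steps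
  \<open>\<gamma> L\<close> is the multisum weighted by \<open>1 / (Q;Q)\<^sub>L\<^sub>-\<^sub>N\<close> with \<open>N = N\<^sub>1\<close>, and it also equals \<open>(-q;Q)\<^sub>L\<close> times the sum
  over \<open>r\<close> of \<open>(-1) ^ r * q ^ ((k + 2) * r\<^sup>2 - 2 * r) / ((Q;Q)\<^sub>L\<^sub>-\<^sub>r * (Q;Q)\<^sub>L\<^sub>+\<^sub>r)\<close>. Letting \<open>L\<close> tend to infinity
  (dominated convergence on both sides) turns the latter into a theta series, which the Jacobi triple
  product evaluates.
\<close>

section \<open>Finite q-series identities\<close>

lemma qpoch_0 [simp]: "qpoch a q 0 = 1"
  by (simp add: qpoch_def)

lemma qpoch_Suc: "qpoch a q (Suc n) = qpoch a q n * (1 - a * q ^ n)"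
  by (simp add: qpoch_def)

lemma qpoch_add: "qpoch a q (m + n) = qpoch a q m * qpoch (a * q ^ m) q n"
  by (induction n) (simp_all add: qpoch_Suc power_add mult.assoc)

lemma qpoch_Suc': "qpoch a q (Suc n) = (1 - a) * qpoch (a * q) q n"
  using qpoch_add[of a q 1 n] by (simp add: qpoch_Suc)

lemma qpoch_zero_left [simp]: "qpoch 0 q n = 1"
  by (simp add: qpoch_def)

lemma power_neq_1:
  fixes q :: complex
  assumes "norm q < 1" "n > 0"
  shows "q ^ n \<noteq> 1"
proof
  assume "q ^ n = 1"
  then have "norm q ^ n = 1"
    by (metis norm_one norm_power)
  moreover have "norm q ^ n < 1"
    using assms by (simp add: power_Suc_less_one power_less_one_iff)
  ultimately show False by simp
qed

lemma qpoch_q_nonzero: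
  assumes "norm q < 1"
  shows "qpoch q q n \<noteq> 0"
proof -
  have "1 - q * q ^ j \<noteq> 0" for j
    using power_neq_1[OF assms, of "Suc j"] by simp
  then show ?thesis by (simp add: qpoch_def)
qed

text \<open>Extending \<open>1 / (q;q)\<^sub>n\<close> by zero to negative \<open>n\<close> keeps the recurrence \<open>inv_qfact_rec\<close> and lets
  all the sums below run over any sufficiently large range.\<close>

definition inv_qfact :: "complex \<Rightarrow> int \<Rightarrow> complex" where
  "inv_qfact q n = (if n < 0 then 0 else 1 / qpoch q q (nat n))"

lemma inv_qfact_neg [simp]: "n < 0 \<Longrightarrow> inv_qfact q n = 0"
  by (simp add: inv_qfact_def)

lemma inv_qfact_0 [simp]: "inv_qfact q 0 = 1"
  by (simp add: inv_qfact_def)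

lemma inv_qfact_of_nat: "inv_qfact q (int n) = 1 / qpoch q q n"
  by (simp add: inv_qfact_def)

text \<open>At \<open>n = 0\<close> the factor \<open>1 - q powi n\<close> vanishes and so does
  \<open>inv_qfact q (- 1)\<close>; this makes the recurrence hold across zero.\<close>

lemma inv_qfact_rec:
  assumes "norm q < 1"
  shows "(1 - q powi n) * inv_qfact q n = inv_qfact q (n - 1)"
proof (cases "n \<le> 0")
  case True
  then show ?thesis by (cases "n = 0") auto
next
  case False
  then obtain m where m: "n = int (Suc m)"
    by (metis not_le zero_less_imp_eq_int Suc_pred)
  have "1 - q ^ Suc m \<noteq> 0"
    using power_neq_1[OF assms, of "Suc m"] by simp
  moreover have "inv_qfact q (n - 1) = 1 / qpoch q q m"
    using m by (simp add: inv_qfact_of_nat)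
  moreover have "inv_qfact q n = 1 / (qpoch q q m * (1 - q ^ Suc m))"
    unfolding m inv_qfact_of_nat qpoch_Suc by simp
  moreover have "q powi n = q ^ Suc m" unfolding m by (rule power_int_of_nat)
  ultimately show ?thesis
    by simp
qed

lemma inv_qfact_rec_nat:
  assumes "norm q < 1"
  shows "(1 - q ^ Suc n) * inv_qfact q (int (Suc n)) = inv_qfact q (int n)"
proof -
  have "int (Suc n) - 1 = int n" by simp
  then show ?thesis
    using inv_qfact_rec[OF assms, of "int (Suc n)"] by (simp only: power_int_of_nat)
qed

text \<open>For a Bailey pair relative to 1, written bilaterally (\<open>\<alpha> r\<close> and \<open>\<alpha> (- r)\<close> are kept apart), this is \<open>\<beta> L\<close>.\<close>

definition bailey_sum :: "complex \<Rightarrow> (int \<Rightarrow> complex) \<Rightarrow> int \<Rightarrow> complex" where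
  "bailey_sum q \<alpha> L = (\<Sum>r\<in>{-L..L}. \<alpha> r * inv_qfact q (L - r) * inv_qfact q (L + r))"

text \<open>Outside \<open>{-L..L}\<close> one of \<open>L - r\<close>, \<open>L + r\<close> is
  negative. This allows Bailey sums for different \<open>L\<close> to be compared over a common
  range.\<close>

lemma bailey_sum_superset:
  assumes "finite A" "{-L..L} \<subseteq> A"
  shows "(\<Sum>r\<in>A. \<alpha> r * inv_qfact q (L - r) * inv_qfact q (L + r)) = bailey_sum q \<alpha> L"
  unfolding bailey_sum_def
proof (rule sum.mono_neutral_right)
  show "\<forall>i\<in>A - {- L..L}. \<alpha> i * inv_qfact q (L - i) * inv_qfact q (L + i) = 0"
    by (auto simp: inv_qfact_def)
qed (use assms in auto)

lemma powi_sub: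
  fixes q :: complex
  assumes "q \<noteq> 0"
  shows "q powi (a - b) = q powi a / q powi b"
  using assms by (rule power_int_diff[OF disjI1])

section \<open>Slater's pair E(4) and the q-Chu-Vandermonde sum\<close>

text \<open>Termwise, the difference of the two sides carries the factor
  \<open>1 - q powi (L + r)\<close>, which lowers the second reciprocal by one index. The sum of
  these differences equals its own negative.\<close>

lemma bailey_sum_shift:
  assumes q: "norm q < 1" "q \<noteq> 0" and L: "L \<ge> 0"
  shows "bailey_sum q (\<lambda>r. (-1) powi r * q powi (r\<^sup>2 - r)) L
           = q powi L * bailey_sum q (\<lambda>r. (-1) powi r * q powi (r\<^sup>2)) L"
proof -
  define t where "t r = (-1) powi r * q powi (r\<^sup>2 - r) * inv_qfact q (L - r) * inv_qfact q (L + r - 1)" for r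
  \<comment> \<open>Multiplying the summand by \<open>1 - q powi (L + r)\<close> makes it antisymmetric under \<open>r \<mapsto> 1 - r\<close>.\<close>
  have t_refl: "t (1 - r) = - t r" for r
  proof -
    have e: "(1 - r)\<^sup>2 - (1 - r) = r\<^sup>2 - r"
      by (simp add: power2_eq_square algebra_simps)
    have s: "(-1::complex) powi (1 - r) = - ((-1) powi r)"
      by (simp add: power_int_minus_left)
    show ?thesis
      unfolding t_def e s by (simp add: algebra_simps)
  qed
  \<comment> \<open>The term \<open>r = - L\<close> contains \<open>inv_qfact q (- 1) = 0\<close>;
    what remains is a range mapped to itself by \<open>r \<mapsto> 1 - r\<close>.\<close>
  have eq: "(\<Sum>r\<in>{-L..L}. t r) = (\<Sum>r\<in>{1-L..L}. t r)"
    by (rule sum.mono_neutral_right) (auto simp: t_def)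
  have "(\<Sum>r\<in>{1-L..L}. t r) = (\<Sum>r\<in>{1-L..L}. t (1 - r))"
    by (rule sum.reindex_bij_witness[of _ "\<lambda>r. 1 - r" "\<lambda>r. 1 - r"]) auto
  also have "\<dots> = - (\<Sum>r\<in>{1-L..L}. t r)"
    by (simp add: t_refl sum_negf)
  finally have "2 * (\<Sum>r\<in>{-L..L}. t r) = 0"
    unfolding eq by (simp only: mult_2 eq_neg_iff_add_eq_0)
  then have t0: "(\<Sum>r\<in>{-L..L}. t r) = 0" by simp
  have "t r = (-1) powi r * q powi (r\<^sup>2 - r) * inv_qfact q (L - r) * inv_qfact q (L + r)
     - q powi L * ((-1) powi r * q powi (r\<^sup>2) * inv_qfact q (L - r) * inv_qfact q (L + r))" for r
  proof -
    have "q powi (r\<^sup>2 - r) * q powi (L + r) = q powi L * q powi (r\<^sup>2)"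
      using q by (simp add: power_int_add[symmetric] add.commute)
    then show ?thesis
      unfolding t_def inv_qfact_rec[OF q(1), of "L + r", symmetric]
      by (simp add: algebra_simps)
  qed
  with t0 show ?thesis
    unfolding bailey_sum_def by (simp add: sum_subtractf sum_distrib_left)
qed

lemma bailey_sum_refl:
  "bailey_sum q (\<lambda>r. \<alpha> (- r)) L = bailey_sum q \<alpha> L"
  unfolding bailey_sum_def
  by (rule sum.reindex_bij_witness[of _ uminus uminus]) (auto simp: algebra_simps)

text \<open>With \<open>L = n + 1\<close>, lowering \<open>L\<close> to \<open>n\<close> brings in
  \<open>(1 - q powi (L - r)) * (1 - q powi (L + r))\<close>. Its two middle terms lead to the sum
  of \<open>bailey_sum_shift\<close> and to its reflection, so the total factor is
  \<open>1 + q powi (2*L) - 2 * q powi (2*L)\<close>.\<close>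

lemma bailey_sum_square_rec:
  assumes q: "norm q < 1" "q \<noteq> 0"
  shows "bailey_sum q (\<lambda>r. (-1) powi r * q powi (r\<^sup>2)) (int n)
          = (1 - q ^ (2 * Suc n)) * bailey_sum q (\<lambda>r. (-1) powi r * q powi (r\<^sup>2)) (int (Suc n))"
proof -
  define L where "L = int (Suc n)"
  define S where "S = bailey_sum q (\<lambda>r. (-1) powi r * q powi (r\<^sup>2)) L"
  define u where "u r = inv_qfact q (L - r) * inv_qfact q (L + r)" for r
  \<comment> \<open>Stated over plain complex variables; \<open>a\<close>, \<open>b\<close>,
    \<open>l\<close> later become \<open>q powi (L - r)\<close>, \<open>q powi (L + r)\<close>,
    \<open>q powi L\<close>.\<close>
  have expand: "s * x * ((1 - a) * f) * ((1 - b) * g)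
      = (1 + c) * (s * x * (f * g)) - l * (s * y * (f * g)) - l * (s * z * (f * g))"
    if "a * b = c" "x * a = l * y" "x * b = l * z" for s x a f b g c l y z :: complex
  proof -
    have "s * x * ((1 - a) * f) * ((1 - b) * g) = s * (f * g) * (x - x * a - x * b + x * (a * b))"
      by (simp add: algebra_simps)
    then show ?thesis unfolding that by (simp add: algebra_simps)
  qed
  have "bailey_sum q (\<lambda>r. (-1) powi r * q powi (r\<^sup>2)) (int n)
     = (\<Sum>r\<in>{-L..L}. (-1) powi r * q powi (r\<^sup>2) * inv_qfact q (int n - r) * inv_qfact q (int n + r))"
    by (rule bailey_sum_superset[symmetric]) (auto simp: L_def)
  also have "\<dots> = (\<Sum>r\<in>{-L..L}. (1 + q powi (2*L)) * ((-1) powi r * q powi (r\<^sup>2) * u r)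
      - q powi L * ((-1) powi r * q powi (r\<^sup>2 - r) * u r)
      - q powi L * ((-1) powi (-r) * q powi ((-r)\<^sup>2 - (-r)) * u r))"
  proof (rule sum.cong[OF refl])
    fix r
    have "inv_qfact q (int n - r) = (1 - q powi (L - r)) * inv_qfact q (L - r)"
      "inv_qfact q (int n + r) = (1 - q powi (L + r)) * inv_qfact q (L + r)"
      using inv_qfact_rec[OF q(1), of "L - r"] inv_qfact_rec[OF q(1), of "L + r"]
      by (auto simp: L_def algebra_simps)
    moreover have e: "q powi (L - r) * q powi (L + r) = q powi (2 * L)"
      "q powi (r\<^sup>2) * q powi (L - r) = q powi L * q powi (r\<^sup>2 - r)"
      "q powi (r\<^sup>2) * q powi (L + r) = q powi L * q powi ((-r)\<^sup>2 - (-r))"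
      using q by (simp_all add: power_int_add[symmetric] algebra_simps)
    ultimately show "(-1) powi r * q powi (r\<^sup>2) * inv_qfact q (int n - r) * inv_qfact q (int n + r)
      = (1 + q powi (2*L)) * ((-1) powi r * q powi (r\<^sup>2) * u r)
      - q powi L * ((-1) powi r * q powi (r\<^sup>2 - r) * u r)
      - q powi L * ((-1) powi (-r) * q powi ((-r)\<^sup>2 - (-r)) * u r)"
      unfolding u_def power_int_minus_one_minus by (simp only: expand[OF e])
  qed
  also have "\<dots> = (1 + q powi (2*L)) * S
      - q powi L * bailey_sum q (\<lambda>r. (-1) powi r * q powi (r\<^sup>2 - r)) L
      - q powi L * bailey_sum q (\<lambda>r. (-1) powi (-r) * q powi ((-r)\<^sup>2 - (-r))) L"
    unfolding S_def bailey_sum_def u_def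
    by (simp only: sum_subtractf sum_distrib_left mult.assoc)
  also have "\<dots> = (1 + q powi (2*L)) * S - 2 * (q powi L * (q powi L * S))"
    unfolding bailey_sum_refl[of q "\<lambda>r. (-1) powi r * q powi (r\<^sup>2 - r)"] S_def
    using bailey_sum_shift[OF q, of L] by (simp add: L_def)
  also have "\<dots> = (1 - q powi (2*L)) * S"
  proof -
    have e: "q powi L * (q powi L * S) = q powi (2 * L) * S"
      using q power_int_add[of q L L] by simp
    show ?thesis unfolding e by (simp add: left_diff_distrib distrib_right)
  qed
  also have "q powi (2*L) = q ^ (2 * Suc n)"
    unfolding L_def by (metis of_nat_mult of_nat_numeral power_int_of_nat)
  finally show ?thesis by (simp only: S_def L_def)
qed

lemma bailey_sum_square:
  assumes q: "norm q < 1" "q \<noteq> 0"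
  shows "bailey_sum q (\<lambda>r. (-1) powi r * q powi (r\<^sup>2)) (int n) = 1 / qpoch (q\<^sup>2) (q\<^sup>2) n"
proof (induction n)
  case 0
  show ?case by (simp add: bailey_sum_def)
next
  case (Suc n)
  have nz: "1 - q ^ (2 * Suc n) \<noteq> 0"
    using power_neq_1[OF q(1), of "2 * Suc n"] by simp
  have "qpoch (q\<^sup>2) (q\<^sup>2) (Suc n) = qpoch (q\<^sup>2) (q\<^sup>2) n * (1 - q ^ (2 * Suc n))"
    by (simp add: qpoch_Suc power_mult power2_eq_square)
  moreover have "bailey_sum q (\<lambda>r. (-1) powi r * q powi (r\<^sup>2)) (int (Suc n))
      = bailey_sum q (\<lambda>r. (-1) powi r * q powi (r\<^sup>2)) (int n) / (1 - q ^ (2 * Suc n))"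
    using nz bailey_sum_square_rec[OF q, of n] by simp
  ultimately show ?case
    using Suc by simp
qed

text \<open>Pair E(4) of Slater's list.\<close>

lemma bailey_pair_E4:
  assumes q: "norm q < 1" "q \<noteq> 0"
  shows "bailey_sum q (\<lambda>r. (-1) powi r * q powi (r\<^sup>2 - r)) (int n) = q ^ n / qpoch (q\<^sup>2) (q\<^sup>2) n"
  using bailey_sum_shift[OF q, of "int n"] bailey_sum_square[OF q, of n] by simp

text \<open>The q-Chu-Vandermonde sum with \<open>c = b * d\<close>, multiplied by \<open>(c;q)\<^sub>M\<close> so that no denominators
  in \<open>b\<close> and \<open>d\<close> occur; \<open>b = 0\<close> is then the finite q-binomial theorem.\<close>

lemma q_vandermonde:
  assumes q: "norm q < 1"
  shows "(\<Sum>m\<le>M. inv_qfact q (int (M - m)) * inv_qfact q (int m) * qpoch b q m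
            * qpoch (b * d * q ^ m) q (M - m) * (- d) ^ m * q ^ (m choose 2))
          = qpoch d q M * inv_qfact q (int M)"
\<comment> \<open>The step splits \<open>1 - q ^ Suc M\<close> as
  \<open>(1 - q ^ (Suc M - m)) + q ^ (Suc M - m) * (1 - q ^ m)\<close>. The first part lowers
  \<open>M\<close>; the second lowers both \<open>M\<close> and \<open>m\<close> and turns
  \<open>b\<close> into \<open>b * q\<close>, hence the generalisation over
  \<open>b\<close>.\<close>
proof (induction M arbitrary: b)
  case 0
  show ?case by (simp add: inv_qfact_def numeral_2_eq_2)
next
  case (Suc M)
  define T where "T M b m = inv_qfact q (int (M - m)) * inv_qfact q (int m) * qpoch b q m
            * qpoch (b * d * q ^ m) q (M - m) * (- d) ^ m * q ^ (m choose 2)" for M b m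
  have nz: "1 - q ^ Suc M \<noteq> 0"
    using power_neq_1[OF q, of "Suc M"] by simp
  have IH: "(\<Sum>m\<le>M. T M b m) = qpoch d q M * inv_qfact q (int M)" for b
    using Suc.IH unfolding T_def by simp
  have a1: "(1 - q ^ (Suc M - m)) * T (Suc M) b m = (1 - b * d * q ^ M) * T M b m" if "m \<le> M" for m
  proof -
    have "Suc M - m = Suc (M - m)" using that by simp
    moreover have "qpoch (b * d * q ^ m) q (Suc (M - m))
        = qpoch (b * d * q ^ m) q (M - m) * (1 - b * d * q ^ M)"
      using that by (simp add: qpoch_Suc power_add[symmetric] mult.assoc)
    ultimately show ?thesis
      unfolding T_def using inv_qfact_rec_nat[OF q, of "M - m"]
      by (simp del: of_nat_Suc power_Suc)
  qed
  have a2: "q ^ (Suc M - Suc m) * (1 - q ^ Suc m) * T (Suc M) b (Suc m)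
      = - d * q ^ M * (1 - b) * T M (b * q) m" if "m \<le> M" for m
  proof -
    have "q ^ (M - m) * q ^ (Suc m choose 2) = q ^ M * q ^ (m choose 2)"
      using that by (simp add: numeral_2_eq_2 power_add[symmetric])
    moreover have "b * d * q ^ Suc m = b * q * d * q ^ m" by simp
    moreover have "x * v * (A * B * ((1 - b) * P) * W * (- d * D) * C)
        = - d * y * (1 - b) * (A * (v * B) * P * W * D * C')"
      if "x * C = y * C'" for x v A B P W D C y C' :: complex
    proof -
      have "x * v * (A * B * ((1 - b) * P) * W * (- d * D) * C)
          = (x * C) * (v * (A * B * ((1 - b) * P) * W * (- d * D)))"
        by (simp only: mult_ac)
      then show ?thesis unfolding that by (simp only: mult_ac mult_minus_left mult_minus_right)
    qed
    ultimately show ?thesis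
      unfolding T_def diff_Suc_Suc qpoch_Suc'[of b] power_Suc[of "-d"]
        inv_qfact_rec_nat[OF q, of m, symmetric]
      by (simp only:)
  qed
  have "(1 - q ^ Suc M) * (\<Sum>m\<le>Suc M. T (Suc M) b m)
     = (\<Sum>m\<le>Suc M. (1 - q ^ (Suc M - m)) * T (Suc M) b m + q ^ (Suc M - m) * (1 - q ^ m) * T (Suc M) b m)"
    unfolding sum_distrib_left
  proof (rule sum.cong[OF refl])
    fix m assume "m \<in> {..Suc M}"
    then have e: "q ^ Suc M = q ^ (Suc M - m) * q ^ m"
      by (simp add: power_add[symmetric])
    show "(1 - q ^ Suc M) * T (Suc M) b m = (1 - q ^ (Suc M - m)) * T (Suc M) b m + q ^ (Suc M - m) * (1 - q ^ m) * T (Suc M) b m"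
      unfolding e by (simp add: left_diff_distrib right_diff_distrib)
  qed
  also have "\<dots> = (\<Sum>m\<le>Suc M. (1 - q ^ (Suc M - m)) * T (Suc M) b m)
     + (\<Sum>m\<le>Suc M. q ^ (Suc M - m) * (1 - q ^ m) * T (Suc M) b m)"
    by (rule sum.distrib)
  \<comment> \<open>Here the term \<open>m = Suc M\<close> vanishes; in the other sum the term
    \<open>m = 0\<close> does, and the index is shifted.\<close>
  also have "(\<Sum>m\<le>Suc M. (1 - q ^ (Suc M - m)) * T (Suc M) b m)
     = (\<Sum>m\<le>M. (1 - b * d * q ^ M) * T M b m)"
    using a1 by simp
  also have "(\<Sum>m\<le>Suc M. q ^ (Suc M - m) * (1 - q ^ m) * T (Suc M) b m)
     = (\<Sum>m\<le>M. - d * q ^ M * (1 - b) * T M (b * q) m)"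
    using a2 by (subst sum.atMost_Suc_shift) simp
  also have "(\<Sum>m\<le>M. (1 - b * d * q ^ M) * T M b m) + (\<Sum>m\<le>M. - d * q ^ M * (1 - b) * T M (b * q) m)
     = qpoch d q (Suc M) * inv_qfact q (int M)"
    unfolding sum_distrib_left[symmetric] IH qpoch_Suc by (simp add: algebra_simps)
  \<comment> \<open>The value given by the induction hypothesis does not depend on \<open>b\<close>,
    and the coefficients add up to \<open>1 - d * q ^ M\<close>.\<close>
  also have "\<dots> = (1 - q ^ Suc M) * (qpoch d q (Suc M) * inv_qfact q (int (Suc M)))"
    using inv_qfact_rec_nat[OF q, of M, symmetric] by simp
  finally show ?case
    using nz unfolding T_def by simp
qed

section \<open>The Bailey lemma and its iteration\<close>

lemma two_times_choose_two: "2 * (m choose 2) = m * (m - 1)"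
  by (induction m) (auto simp: numeral_2_eq_2 algebra_simps)

text \<open>Apply \<open>q_vandermonde\<close> in base \<open>q\<^sup>2\<close> with
  \<open>b = d = - (q ^ (2 * s + 1))\<close>. Then \<open>b * d * (q\<^sup>2) ^ m\<close> is the
  first factor missing from \<open>(q\<^sup>2;q\<^sup>2)\<close> of length \<open>2 * s + m\<close>,
  so the shifted factorial there completes it to length \<open>2 * s + M\<close>.\<close>

lemma bailey_kernel_nat:
  assumes q: "norm q < 1"
  shows "(\<Sum>m\<le>M. inv_qfact (q\<^sup>2) (int (M - m)) * inv_qfact (q\<^sup>2) (int m) * inv_qfact (q\<^sup>2) (int (2 * s + m))
            * q ^ (s + m)\<^sup>2 * qpoch (- q) (q\<^sup>2) (s + m))
          = q ^ s\<^sup>2 * qpoch (- q) (q\<^sup>2) (s + M) * inv_qfact (q\<^sup>2) (int M) * inv_qfact (q\<^sup>2) (int (2 * s + M))"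
proof -
  define b where "b = - (q ^ (2 * s + 1))"
  \<comment> \<open>Collects the factors independent of \<open>m\<close>, including the completed
    factorial of length \<open>2 * s + M\<close>.\<close>
  define c where "c = q ^ s\<^sup>2 * qpoch (- q) (q\<^sup>2) s * inv_qfact (q\<^sup>2) (int (2 * s + M))"
  have q2: "norm (q\<^sup>2) < 1" using q by (simp add: norm_power power_less_one_iff)
  have bq: "- q * (q\<^sup>2) ^ s = b" by (simp add: b_def power_mult)
  have term_eq: "c * (inv_qfact (q\<^sup>2) (int (M - m)) * inv_qfact (q\<^sup>2) (int m) * qpoch b (q\<^sup>2) m
            * qpoch (b * b * (q\<^sup>2) ^ m) (q\<^sup>2) (M - m) * (- b) ^ m * (q\<^sup>2) ^ (m choose 2))
      = inv_qfact (q\<^sup>2) (int (M - m)) * inv_qfact (q\<^sup>2) (int m) * inv_qfact (q\<^sup>2) (int (2 * s + m))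
            * q ^ (s + m)\<^sup>2 * qpoch (- q) (q\<^sup>2) (s + m)"
    if "m \<le> M" for m
  proof -
    have 1: "qpoch (- q) (q\<^sup>2) s * qpoch b (q\<^sup>2) m = qpoch (- q) (q\<^sup>2) (s + m)"
      unfolding qpoch_add bq ..
    have "b * b * (q\<^sup>2) ^ m = q\<^sup>2 * (q\<^sup>2) ^ (2 * s + m)"
      by (simp add: b_def power_mult[symmetric] power_add[symmetric] algebra_simps
               flip: power_Suc)
    moreover have "2 * s + M = (2 * s + m) + (M - m)" using that by simp
    ultimately have "qpoch (q\<^sup>2) (q\<^sup>2) (2 * s + M)
        = qpoch (q\<^sup>2) (q\<^sup>2) (2 * s + m) * qpoch (b * b * (q\<^sup>2) ^ m) (q\<^sup>2) (M - m)"
      by (metis qpoch_add)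
    then have 2: "inv_qfact (q\<^sup>2) (int (2 * s + M)) * qpoch (b * b * (q\<^sup>2) ^ m) (q\<^sup>2) (M - m)
         = inv_qfact (q\<^sup>2) (int (2 * s + m))"
      unfolding inv_qfact_of_nat using qpoch_q_nonzero[OF q2, of "2 * s + M"] by (auto simp: field_simps)
    have "s\<^sup>2 + ((2 * s + 1) * m + 2 * (m choose 2)) = (s + m)\<^sup>2"
      unfolding two_times_choose_two by (cases m) (auto simp: power2_eq_square algebra_simps)
    then have 3: "q ^ s\<^sup>2 * ((- b) ^ m * (q\<^sup>2) ^ (m choose 2)) = q ^ (s + m)\<^sup>2"
      by (simp only: b_def minus_minus power_mult[symmetric] power_add[symmetric])
    show ?thesis unfolding c_def 1[symmetric] 2[symmetric] 3[symmetric] by (simp only: mult_ac)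
  qed
  have "(\<Sum>m\<le>M. inv_qfact (q\<^sup>2) (int (M - m)) * inv_qfact (q\<^sup>2) (int m) * inv_qfact (q\<^sup>2) (int (2 * s + m))
            * q ^ (s + m)\<^sup>2 * qpoch (- q) (q\<^sup>2) (s + m)) = c * (qpoch b (q\<^sup>2) M * inv_qfact (q\<^sup>2) (int M))"
    unfolding q_vandermonde[OF q2, of M b b, symmetric] sum_distrib_left
    by (intro sum.cong term_eq[symmetric]) auto
  also have "\<dots> = q ^ s\<^sup>2 * qpoch (- q) (q\<^sup>2) (s + M) * inv_qfact (q\<^sup>2) (int M) * inv_qfact (q\<^sup>2) (int (2 * s + M))"
    unfolding c_def qpoch_add bq by (simp only: mult_ac)
  finally show ?thesis .
qed

text \<open>This compares the coefficients of \<open>\<alpha> s\<close> in the Bailey lemma. Both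
  sides are even in \<open>s\<close>; for \<open>0 \<le> s \<le> L\<close> only
  \<open>r = s + m\<close> contributes, and for \<open>s > L\<close> both sides vanish.\<close>

lemma bailey_kernel:
  assumes q: "norm q < 1"
  shows "(\<Sum>r\<le>L. inv_qfact (q\<^sup>2) (int L - int r) * q ^ r\<^sup>2 * qpoch (- q) (q\<^sup>2) r
            * inv_qfact (q\<^sup>2) (int r - s) * inv_qfact (q\<^sup>2) (int r + s))
          = qpoch (- q) (q\<^sup>2) L * q powi (s\<^sup>2) * inv_qfact (q\<^sup>2) (int L - s) * inv_qfact (q\<^sup>2) (int L + s)"
proof -
  have main: "(\<Sum>r\<le>L. inv_qfact (q\<^sup>2) (int L - int r) * q ^ r\<^sup>2 * qpoch (- q) (q\<^sup>2) r
            * inv_qfact (q\<^sup>2) (int r - int s) * inv_qfact (q\<^sup>2) (int r + int s))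
          = qpoch (- q) (q\<^sup>2) L * q ^ s\<^sup>2 * inv_qfact (q\<^sup>2) (int L - int s) * inv_qfact (q\<^sup>2) (int L + int s)" for s
  proof (cases "s \<le> L")
    case False
    then show ?thesis by simp
  next
    case True
    define M where "M = L - s"
    have L: "L = s + M" using True by (simp add: M_def)
    have "(\<Sum>r\<le>L. inv_qfact (q\<^sup>2) (int L - int r) * q ^ r\<^sup>2 * qpoch (- q) (q\<^sup>2) r
            * inv_qfact (q\<^sup>2) (int r - int s) * inv_qfact (q\<^sup>2) (int r + int s))
       = (\<Sum>r\<in>{s..L}. inv_qfact (q\<^sup>2) (int L - int r) * q ^ r\<^sup>2 * qpoch (- q) (q\<^sup>2) r
            * inv_qfact (q\<^sup>2) (int r - int s) * inv_qfact (q\<^sup>2) (int r + int s))"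
      by (rule sum.mono_neutral_right) auto
    also have "\<dots> = (\<Sum>m\<le>M. inv_qfact (q\<^sup>2) (int (M - m)) * inv_qfact (q\<^sup>2) (int m) * inv_qfact (q\<^sup>2) (int (2 * s + m))
            * q ^ (s + m)\<^sup>2 * qpoch (- q) (q\<^sup>2) (s + m))"
      by (rule sum.reindex_bij_witness[of _ "\<lambda>m. s + m" "\<lambda>r. r - s"])
         (auto simp: L of_nat_diff algebra_simps)
    also have "\<dots> = qpoch (- q) (q\<^sup>2) L * q ^ s\<^sup>2 * inv_qfact (q\<^sup>2) (int L - int s) * inv_qfact (q\<^sup>2) (int L + int s)"
      unfolding bailey_kernel_nat[OF q] by (simp add: L algebra_simps)
    finally show ?thesis .
  qed
  show ?thesis
  proof (cases "s \<ge> 0")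
    case True
    then show ?thesis
      using main[of "nat s"] by (simp add: power_int_def nat_power_eq)
  next
    case False
    then show ?thesis
      using main[of "nat (- s)"] by (simp add: power_int_def nat_power_eq[symmetric] mult_ac)
  qed
qed

text \<open>Extend all inner sums to \<open>{-L..L}\<close>, interchange the summations and evaluate
  the sum over \<open>r\<close> by \<open>bailey_kernel\<close>.\<close>

lemma bailey_lemma:
  assumes q: "norm q < 1"
  shows "(\<Sum>r\<le>L. inv_qfact (q\<^sup>2) (int L - int r) * q ^ r\<^sup>2 * (qpoch (- q) (q\<^sup>2) r * bailey_sum (q\<^sup>2) \<alpha> (int r)))
          = qpoch (- q) (q\<^sup>2) L * bailey_sum (q\<^sup>2) (\<lambda>s. q powi (s\<^sup>2) * \<alpha> s) (int L)"
proof -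
  have "(\<Sum>r\<le>L. inv_qfact (q\<^sup>2) (int L - int r) * q ^ r\<^sup>2 * (qpoch (- q) (q\<^sup>2) r * bailey_sum (q\<^sup>2) \<alpha> (int r)))
     = (\<Sum>r\<le>L. \<Sum>s\<in>{-int L..int L}. \<alpha> s * (inv_qfact (q\<^sup>2) (int L - int r) * q ^ r\<^sup>2 * qpoch (- q) (q\<^sup>2) r
            * inv_qfact (q\<^sup>2) (int r - s) * inv_qfact (q\<^sup>2) (int r + s)))"
  proof (rule sum.cong[OF refl])
    fix r assume "r \<in> {..L}"
    then have e: "bailey_sum (q\<^sup>2) \<alpha> (int r) = (\<Sum>s\<in>{-int L..int L}. \<alpha> s * inv_qfact (q\<^sup>2) (int r - s) * inv_qfact (q\<^sup>2) (int r + s))"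
      by (intro bailey_sum_superset[symmetric]) auto
    show "inv_qfact (q\<^sup>2) (int L - int r) * q ^ r\<^sup>2 * (qpoch (- q) (q\<^sup>2) r * bailey_sum (q\<^sup>2) \<alpha> (int r))
      = (\<Sum>s\<in>{-int L..int L}. \<alpha> s * (inv_qfact (q\<^sup>2) (int L - int r) * q ^ r\<^sup>2 * qpoch (- q) (q\<^sup>2) r
            * inv_qfact (q\<^sup>2) (int r - s) * inv_qfact (q\<^sup>2) (int r + s)))"
      unfolding e sum_distrib_left by (simp only: mult_ac)
  qed
  also have "\<dots> = (\<Sum>s\<in>{-int L..int L}. \<alpha> s * (\<Sum>r\<le>L. inv_qfact (q\<^sup>2) (int L - int r) * q ^ r\<^sup>2 * qpoch (- q) (q\<^sup>2) r
            * inv_qfact (q\<^sup>2) (int r - s) * inv_qfact (q\<^sup>2) (int r + s)))"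
    unfolding sum_distrib_left by (rule sum.swap)
  also have "\<dots> = qpoch (- q) (q\<^sup>2) L * bailey_sum (q\<^sup>2) (\<lambda>s. q powi (s\<^sup>2) * \<alpha> s) (int L)"
    unfolding bailey_kernel[OF q] bailey_sum_def sum_distrib_left by (simp only: mult_ac)
  finally show ?thesis .
qed

text \<open>The extra factor \<open>(-q;q\<^sup>2)\<^sub>L\<close> of the Bailey lemma is absorbed into the sequence: the chain consists of
  the numbers \<open>(-q;q\<^sup>2)\<^sub>L \<beta> L\<close>.\<close>

primrec bailey_chain :: "complex \<Rightarrow> nat \<Rightarrow> nat \<Rightarrow> complex" where
  "bailey_chain q 0 L = qpoch (- q) (q\<^sup>2) L * q ^ (2 * L) / qpoch (q ^ 4) (q ^ 4) L"
| "bailey_chain q (Suc k) L = (\<Sum>r\<le>L. inv_qfact (q\<^sup>2) (int L - int r) * q ^ r\<^sup>2 * bailey_chain q k r)"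

text \<open>The start is E(4) in base \<open>q\<^sup>2\<close>, with exponent
  \<open>2 * r\<^sup>2 - 2 * r\<close>; each application of the Bailey lemma adds
  \<open>r\<^sup>2\<close>.\<close>

lemma bailey_chain_eq:
  assumes q: "norm q < 1" "q \<noteq> 0"
  shows "bailey_chain q k L = qpoch (- q) (q\<^sup>2) L
           * bailey_sum (q\<^sup>2) (\<lambda>r. (-1) powi r * q powi ((int k + 2) * r\<^sup>2 - 2 * r)) (int L)"
proof (induction k arbitrary: L)
  case 0
  have "norm (q\<^sup>2) < 1" "q\<^sup>2 \<noteq> 0" using q by (simp_all add: norm_power power_less_one_iff)
  from bailey_pair_E4[OF this, of L]
  have "bailey_sum (q\<^sup>2) (\<lambda>r. (-1) powi r * q powi (2 * (r\<^sup>2 - r))) (int L) = q ^ (2 * L) / qpoch (q ^ 4) (q ^ 4) L"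
    by (simp add: power_int_power power_mult[symmetric])
  then show ?case by (simp add: right_diff_distrib)
next
  case (Suc k)
  have e: "q powi (s\<^sup>2) * ((-1) powi s * q powi ((int k + 2) * s\<^sup>2 - 2 * s))
      = (-1) powi s * q powi ((int (Suc k) + 2) * s\<^sup>2 - 2 * s)" for s
  proof -
    have "s\<^sup>2 + ((int k + 2) * s\<^sup>2 - 2 * s) = (int (Suc k) + 2) * s\<^sup>2 - 2 * s"
      by (simp add: algebra_simps)
    then have "q powi ((int (Suc k) + 2) * s\<^sup>2 - 2 * s) = q powi (s\<^sup>2) * q powi ((int k + 2) * s\<^sup>2 - 2 * s)"
      using q by (metis power_int_add)
    then show ?thesis by simp
  qed
  show ?case
    unfolding bailey_chain.simps Suc.IH bailey_lemma[OF q(1)] e ..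
qed

section \<open>The finite Jacobi triple product\<close>

text \<open>Each factor \<open>1 - z / p ^ i\<close> with \<open>1 \<le> i \<le> L\<close> is
  \<open>- (z / p ^ i) * (1 - p ^ i / z)\<close>; the powers of \<open>p\<close> collect to the
  triangular number.\<close>

lemma qpoch_shift_down:
  assumes "p \<noteq> 0" "z \<noteq> 0"
  shows "qpoch (z / p ^ L) p L * p ^ (Suc L choose 2) = (- z) ^ L * qpoch (p / z) p L"
proof (induction L)
  case 0
  show ?case by (simp add: numeral_2_eq_2)
next
  case (Suc L)
  have "z / p ^ Suc L * p = z / p ^ L" using assms by simp
  then have "qpoch (z / p ^ Suc L) p (Suc L) = (1 - z / p ^ Suc L) * qpoch (z / p ^ L) p L"
    by (simp only: qpoch_Suc')
  moreover have "p ^ (Suc (Suc L) choose 2) = p ^ (Suc L choose 2) * p ^ Suc L"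
    by (simp add: numeral_2_eq_2 power_add)
  moreover have "(1 - z / p ^ Suc L) * p ^ Suc L = - z * (1 - p / z * p ^ L)"
    using assms by (simp add: field_simps)
  ultimately have "qpoch (z / p ^ Suc L) p (Suc L) * p ^ (Suc (Suc L) choose 2)
      = (- z * (1 - p / z * p ^ L)) * (qpoch (z / p ^ L) p L * p ^ (Suc L choose 2))"
    by (metis mult.assoc mult.commute)
  then show ?case
    unfolding Suc.IH by (simp add: qpoch_Suc)
qed

text \<open>The finite q-binomial theorem of order \<open>2 * L\<close>, centred by
  \<open>m = L + r\<close> and \<open>d = z / p ^ L\<close>.\<close>

lemma finite_jacobi_triple_product:
  assumes p: "norm p < 1" "p \<noteq> 0" and z: "z \<noteq> 0"
  shows "bailey_sum p (\<lambda>r. (-1) powi r * z powi r * p powi (r * (r - 1) div 2)) (int L)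
           = qpoch z p L * qpoch (p / z) p L * inv_qfact p (int (2 * L))"
proof -
  define d where "d = z / p ^ L"
  \<comment> \<open>Centring changes each summand by this factor; \<open>qpoch_shift_down\<close>
    produces the same factor on the product side.\<close>
  define f where "f = (- z) ^ L / p ^ (Suc L choose 2)"
  have fnz: "f \<noteq> 0" using p z by (simp add: f_def)
  have term_eq: "(- d) ^ nat (int L + r) * p ^ (nat (int L + r) choose 2)
     = f * ((-1) powi r * z powi r * p powi (r * (r - 1) div 2))" if "- int L \<le> r" for r
  proof -
    define m where "m = nat (int L + r)"
    have m: "int m = int L + r" using that by (simp add: m_def)
    \<comment> \<open>Exponents are compared after doubling; \<open>r * (r - 1)\<close> is even, so
      its \<open>div 2\<close> is exact.\<close>
    have "2 * int (m choose 2) = int m * (int m - 1)"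
      using arg_cong[OF two_times_choose_two[of m], of int] by (cases m) (simp_all add: algebra_simps)
    moreover have "2 * int (Suc L choose 2) = (int L + 1) * int L"
      using arg_cong[OF two_times_choose_two[of "Suc L"], of int] by (simp add: algebra_simps)
    moreover have "even (r * (r - 1))" by simp
    then have "2 * (r * (r - 1) div 2) = r * (r - 1)"
      by (rule dvd_mult_div_cancel)
    ultimately have "2 * (int (m choose 2) - int L * int m)
      = 2 * (r * (r - 1) div 2 - int (Suc L choose 2))"
      unfolding m right_diff_distrib by (simp add: algebra_simps)
    then have e: "int (m choose 2) - int L * int m = r * (r - 1) div 2 - int (Suc L choose 2)" by simp
    have "(- d) ^ m * p ^ (m choose 2) = (- z) ^ m * (p powi int (m choose 2) / p powi (int L * int m))"
    proof -
      have "(- d) ^ m = (- z) ^ m / p ^ (L * m)"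
        unfolding d_def minus_divide_left power_divide power_mult ..
      moreover have "p powi int (m choose 2) = p ^ (m choose 2)" "p powi (int L * int m) = p ^ (L * m)"
        by (simp_all flip: of_nat_mult)
      ultimately show ?thesis by simp
    qed
    also have "\<dots> = (- z) ^ m * (p powi (r * (r - 1) div 2) / p ^ (Suc L choose 2))"
      unfolding powi_sub[OF p(2), symmetric] e unfolding powi_sub[OF p(2)] by simp
    also have "(- z) ^ m = (- z) ^ L * (- z) powi r"
      using z by (metis m power_int_of_nat power_int_add neg_equal_0_iff_equal)
    also have "(- z) powi r = (-1) powi r * z powi r"
      by (metis mult_minus1 power_int_mult_distrib)
    finally show ?thesis unfolding m_def f_def by simp
  qed
  have "f * bailey_sum p (\<lambda>r. (-1) powi r * z powi r * p powi (r * (r - 1) div 2)) (int L)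
     = (\<Sum>r\<in>{-int L..int L}. f * ((-1) powi r * z powi r * p powi (r * (r - 1) div 2))
          * inv_qfact p (int L - r) * inv_qfact p (int L + r))"
    unfolding bailey_sum_def sum_distrib_left by (simp only: mult.assoc)
  also have "\<dots> = (\<Sum>m\<le>2 * L. inv_qfact p (int (2 * L - m)) * inv_qfact p (int m) * (- d) ^ m * p ^ (m choose 2))"
  proof (rule sum.reindex_bij_witness[of _ "\<lambda>m. int m - int L" "\<lambda>r. nat (int L + r)"])
    fix r assume r: "r \<in> {- int L..int L}"
    then have "int (2 * L - nat (int L + r)) = int L - r" "int (nat (int L + r)) = int L + r"
      by (auto simp: of_nat_diff)
    then show "inv_qfact p (int (2 * L - nat (int L + r))) * inv_qfact p (int (nat (int L + r)))
        * (- d) ^ nat (int L + r) * p ^ (nat (int L + r) choose 2)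
       = f * ((-1) powi r * z powi r * p powi (r * (r - 1) div 2))
          * inv_qfact p (int L - r) * inv_qfact p (int L + r)"
      using term_eq[of r] r by (simp add: mult.assoc)
  qed auto
  also have "\<dots> = qpoch d p (2 * L) * inv_qfact p (int (2 * L))"
    using q_vandermonde[OF p(1), of "2 * L" 0 d] by simp
  also have "qpoch d p (2 * L) = f * qpoch (p / z) p L * qpoch z p L"
  proof -
    have "qpoch d p (2 * L) = qpoch d p L * qpoch z p L"
      using p by (simp add: mult_2 qpoch_add d_def)
    moreover have "qpoch d p L = f * qpoch (p / z) p L"
      using qpoch_shift_down[OF p(2) z, of L] p by (simp add: d_def f_def field_simps)
    ultimately show ?thesis by simp
  qed
  finally show ?thesis using fnz by (simp add: mult_ac)
qed

section \<open>Limits\<close>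

lemma convergent_prod_qpoch:
  fixes a q :: complex
  assumes "norm q < 1"
  shows "convergent_prod (\<lambda>j. 1 - a * q ^ j)"
proof -
  have "summable (\<lambda>j. norm ((1 - a * q ^ j) - 1))"
    using assms by (simp add: norm_mult norm_power summable_mult summable_geometric)
  then show ?thesis
    by (intro abs_convergent_prod_imp_convergent_prod summable_imp_abs_convergent_prod)
qed

lemma qpoch_tendsto:
  assumes "norm q < 1"
  shows "(\<lambda>n. qpoch a q n) \<longlonglongrightarrow> qpoch_inf a q"
  unfolding qpoch_def qpoch_inf_def
  by (intro has_prod_imp_tendsto' convergent_prod_has_prod convergent_prod_qpoch assms)

lemma qpoch_inf_q_nonzero:
  assumes "norm q < 1"
  shows "qpoch_inf q q \<noteq> 0"
  unfolding qpoch_inf_def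
proof (rule prodinf_nonzero[OF convergent_prod_qpoch[OF assms]])
  show "1 - q * q ^ j \<noteq> 0" for j
    using power_neq_1[OF assms, of "Suc j"] by simp
qed

lemma qpoch_bounded:
  assumes "norm q < 1"
  obtains C where "\<And>n. norm (qpoch a q n) \<le> C"
proof -
  have "Bseq (\<lambda>n. qpoch a q n)"
    using qpoch_tendsto[OF assms] by (intro convergent_imp_Bseq convergentI)
  then obtain C where "\<forall>n. norm (qpoch a q n) \<le> C"
    by (rule BseqE)
  with that show ?thesis by blast
qed

lemma inv_qfact_tendsto:
  assumes "norm q < 1"
  shows "(\<lambda>L. inv_qfact q (int L + r)) \<longlonglongrightarrow> 1 / qpoch_inf q q"
proof -
  have "(\<lambda>n. 1 / qpoch q q n) \<longlonglongrightarrow> 1 / qpoch_inf q q"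
    by (intro tendsto_divide tendsto_const qpoch_tendsto qpoch_inf_q_nonzero assms)
  moreover have "filterlim (\<lambda>L. nat (int L + r)) at_top sequentially"
    unfolding filterlim_at_top
  proof
    fix Z
    show "\<forall>\<^sub>F L in sequentially. Z \<le> nat (int L + r)"
      using eventually_ge_at_top[of "nat (int Z - r)"] by eventually_elim linarith
  qed
  ultimately have "(\<lambda>L. 1 / qpoch q q (nat (int L + r))) \<longlonglongrightarrow> 1 / qpoch_inf q q"
    by (rule filterlim_compose)
  moreover have "\<forall>\<^sub>F L in sequentially. 1 / qpoch q q (nat (int L + r)) = inv_qfact q (int L + r)"
    using eventually_ge_at_top[of "nat (- r)"] by eventually_elim (auto simp: inv_qfact_def)
  ultimately show ?thesis
    by (rule Lim_transform_eventually)
qed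

text \<open>A convergent sequence is bounded, and negative indices give zero. The bound supplies the
  majorants for dominated convergence.\<close>

lemma inv_qfact_bounded:
  assumes "norm q < 1"
  obtains C where "C > 0" "\<And>n. norm (inv_qfact q n) \<le> C"
proof -
  have "Bseq (\<lambda>L. inv_qfact q (int L))"
    using inv_qfact_tendsto[OF assms, of 0] by (intro convergent_imp_Bseq convergentI) simp
  then obtain C where C: "C > 0" "\<And>L. norm (inv_qfact q (int L)) \<le> C"
    by (auto elim: BseqE)
  have "norm (inv_qfact q n) \<le> C" for n
    using C(1) C(2)[of "nat n"] by (cases "n \<ge> 0") auto
  with C(1) that show ?thesis by blast
qed

section \<open>Dominated convergence and the Jacobi triple product\<close>

text \<open>Tannery's theorem for unordered sums: by the Weierstrass M-test the finite partial sums
  converge uniformly in \<open>n\<close>, so the two limits may be exchanged.\<close>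

lemma tannery_infsum:
  fixes f :: "nat \<Rightarrow> 'a \<Rightarrow> 'b :: banach" and M :: "'a \<Rightarrow> real"
  assumes bound: "\<And>n x. x \<in> X \<Longrightarrow> norm (f n x) \<le> M x"
    and M: "M summable_on X"
    and lim: "\<And>x. x \<in> X \<Longrightarrow> (\<lambda>n. f n x) \<longlonglongrightarrow> g x"
  shows "(\<lambda>n. infsum (f n) X) \<longlonglongrightarrow> infsum g X"
proof -
  have "norm (g x) \<le> M x" if "x \<in> X" for x
    using lim[OF that] bound[OF that] by (intro Lim_bounded[OF tendsto_norm]) auto
  then have g: "g summable_on X"
    using Infinite_Sum.abs_summable_on_comparison_test'[OF M] abs_summable_summable by metis
  have unif: "uniform_limit UNIV (\<lambda>F n. \<Sum>x\<in>F. f n x) (\<lambda>n. infsum (f n) X) (finite_subsets_at_top X)"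
    by (rule Weierstrass_m_test_general[OF bound M])
  show "(\<lambda>n. infsum (f n) X) \<longlonglongrightarrow> infsum g X"
  proof (rule swap_uniform_limit'[OF _ _ unif])
    show "\<forall>\<^sub>F F in finite_subsets_at_top X. (\<lambda>n. \<Sum>x\<in>F. f n x) \<longlonglongrightarrow> (\<Sum>x\<in>F. g x)"
      by (intro eventually_finite_subsets_at_top_weakI tendsto_sum lim) auto
    show "((\<lambda>F. \<Sum>x\<in>F. g x) \<longlongrightarrow> infsum g X) (finite_subsets_at_top X)"
      using g by (rule infsum_tendsto)
  qed simp_all
qed

text \<open>Both reciprocals tend to \<open>1 / qpoch_inf q q\<close> for fixed \<open>r\<close> and
  are uniformly bounded, so a multiple of \<open>norm (\<alpha> r)\<close> dominates.\<close>

lemma bailey_sum_tendsto: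
  assumes q: "norm q < 1" and \<alpha>: "(\<lambda>r. norm (\<alpha> r)) summable_on UNIV"
  shows "(\<lambda>L. bailey_sum q \<alpha> (int L)) \<longlonglongrightarrow> infsum \<alpha> UNIV / (qpoch_inf q q)\<^sup>2"
proof -
  obtain C where C: "C > 0" "\<And>n. norm (inv_qfact q n) \<le> C"
    using inv_qfact_bounded[OF q] by blast
  define f where "f L r = \<alpha> r * inv_qfact q (int L - r) * inv_qfact q (int L + r)" for L r
  have f_inf: "infsum (f L) UNIV = bailey_sum q \<alpha> (int L)" for L
  proof -
    have "infsum (f L) UNIV = infsum (f L) {- int L..int L}"
      by (rule infsum_cong_neutral) (auto simp: f_def not_le)
    then show ?thesis by (simp add: bailey_sum_def f_def)
  qed
  have "(\<lambda>L. infsum (f L) UNIV) \<longlonglongrightarrow> infsum (\<lambda>r. \<alpha> r * (1 / (qpoch_inf q q)\<^sup>2)) UNIV"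
  proof (rule tannery_infsum)
    show "norm (f L r) \<le> norm (\<alpha> r) * (C * C)" for L r
      unfolding f_def norm_mult mult.assoc
      using C by (intro mult_left_mono mult_mono) auto
    show "(\<lambda>r. norm (\<alpha> r) * (C * C)) summable_on UNIV"
      using \<alpha> by (rule summable_on_cmult_left)
    show "(\<lambda>L. f L r) \<longlonglongrightarrow> \<alpha> r * (1 / (qpoch_inf q q)\<^sup>2)" for r
    proof -
      have "(\<lambda>L. \<alpha> r * inv_qfact q (int L + (- r)) * inv_qfact q (int L + r))
          \<longlonglongrightarrow> \<alpha> r * (1 / qpoch_inf q q) * (1 / qpoch_inf q q)"
        by (intro tendsto_mult tendsto_const inv_qfact_tendsto q)
      then show ?thesis by (simp add: f_def power2_eq_square)
    qed
  qed
  then show ?thesis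
    unfolding f_inf infsum_cmult_left' by simp
qed

text \<open>Let \<open>L\<close> tend to infinity in the finite form. The sum side acquires
  \<open>1 / (qpoch_inf p p)\<^sup>2\<close>, the product side only its first power, which leaves
  one factor \<open>qpoch_inf p p\<close>.\<close>

lemma jacobi_triple_product:
  assumes p: "norm p < 1" "p \<noteq> 0" and z: "z \<noteq> 0"
    and summable: "(\<lambda>r. norm ((-1) powi r * z powi r * p powi (r * (r - 1) div 2))) summable_on UNIV"
  shows "(\<Sum>\<^sub>\<infinity>r. (-1) powi r * z powi r * p powi (r * (r - 1) div 2))
           = qpoch_inf p p * qpoch_inf z p * qpoch_inf (p / z) p"
proof -
  have "filterlim (\<lambda>L::nat. 2 * L) at_top sequentially"
    by (simp add: filterlim_at_top_mult_tendsto_pos mult_nat_left_at_top)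
  from filterlim_compose[OF inv_qfact_tendsto[OF p(1), of 0] this]
  have "(\<lambda>L. inv_qfact p (int (2 * L))) \<longlonglongrightarrow> 1 / qpoch_inf p p" by simp
  then have "(\<lambda>L. qpoch z p L * qpoch (p / z) p L * inv_qfact p (int (2 * L)))
      \<longlonglongrightarrow> qpoch_inf z p * qpoch_inf (p / z) p * (1 / qpoch_inf p p)"
    by (intro tendsto_mult qpoch_tendsto p)
  with bailey_sum_tendsto[OF p(1) summable]
  have "(\<Sum>\<^sub>\<infinity>r. (-1) powi r * z powi r * p powi (r * (r - 1) div 2)) / (qpoch_inf p p)\<^sup>2
      = qpoch_inf z p * qpoch_inf (p / z) p * (1 / qpoch_inf p p)"
    unfolding finite_jacobi_triple_product[OF p z] by (rule LIMSEQ_unique)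
  then show ?thesis
    using qpoch_inf_q_nonzero[OF p(1)] by (simp add: field_simps power2_eq_square)
qed

section \<open>Geometric majorants\<close>

lemma summable_on_power_abs_int:
  fixes x :: real
  assumes "0 \<le> x" "x < 1"
  shows "(\<lambda>r::int. x ^ nat \<bar>r\<bar>) summable_on UNIV"
proof -
  have geo: "(\<lambda>n::nat. x ^ n) summable_on UNIV"
    using assms by (intro norm_summable_imp_summable_on) (simp add: norm_power summable_geometric)
  have "(\<lambda>r::int. x ^ nat \<bar>r\<bar>) summable_on {0..} \<longleftrightarrow> (\<lambda>n::nat. x ^ n) summable_on UNIV"
    by (rule summable_on_reindex_bij_witness[of _ int nat]) auto
  moreover have "(\<lambda>r::int. x ^ nat \<bar>r\<bar>) summable_on {..<0} \<longleftrightarrow> (\<lambda>n::nat. x ^ n) summable_on {1..}"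
    by (rule summable_on_reindex_bij_witness[of _ "\<lambda>n. - int n" "\<lambda>r. nat (- r)"]) auto
  moreover have "(\<lambda>n::nat. x ^ n) summable_on {1..}"
    using geo by (rule summable_on_subset_banach) simp
  ultimately have "(\<lambda>r::int. x ^ nat \<bar>r\<bar>) summable_on ({0..} \<union> {..<0})"
    using geo by (intro summable_on_Un_disjoint) auto
  also have "{0..} \<union> {..<0} = (UNIV :: int set)" by auto
  finally show ?thesis .
qed

text \<open>A finite set of tuples lies in a cube, over which the sum factors into partial geometric
  series, each at most \<open>1 / (1 - x)\<close>.\<close>

lemma summable_on_PiE_power:
  fixes x :: real
  assumes "0 \<le> x" "x < 1" "finite A"
  shows "(\<lambda>n. x ^ (\<Sum>i\<in>A. n i)) summable_on (A \<rightarrow>\<^sub>E (UNIV :: nat set))"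
proof (rule nonneg_bounded_partial_sums_imp_summable_on)
  show "0 \<le> x ^ (\<Sum>i\<in>A. n i)" for n using assms by simp
  have "(\<Sum>n\<in>F. x ^ (\<Sum>i\<in>A. n i)) \<le> (1 / (1 - x)) ^ card A"
    if F: "finite F" "F \<subseteq> A \<rightarrow>\<^sub>E UNIV" for F
  proof -
    define B where "B = Max (insert 0 ((\<lambda>(n, i). n i) ` (F \<times> A)))"
    have "n i \<le> B" if "n \<in> F" "i \<in> A" for n i
      unfolding B_def using that F assms by (intro Max_ge) auto
    then have sub: "F \<subseteq> A \<rightarrow>\<^sub>E {..B}"
      using F(2) by (auto simp: PiE_iff)
    have "(\<Sum>n\<in>F. x ^ (\<Sum>i\<in>A. n i)) \<le> (\<Sum>n\<in>A \<rightarrow>\<^sub>E {..B}. x ^ (\<Sum>i\<in>A. n i))"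
      using sub assms by (intro sum_mono2 finite_PiE) auto
    also have "\<dots> = (\<Prod>i\<in>A. \<Sum>y\<le>B. x ^ y)"
      using assms by (subst prod_sum_PiE) (simp_all add: power_sum)
    also have "\<dots> \<le> (\<Prod>i\<in>A. 1 / (1 - x))"
    proof (intro prod_mono conjI sum_nonneg)
      have "(\<Sum>y\<le>B. x ^ y) \<le> (\<Sum>y. x ^ y)"
        using assms by (intro sum_le_suminf summable_geometric) auto
      then show "(\<Sum>y\<le>B. x ^ y) \<le> 1 / (1 - x)"
        using assms by (simp add: suminf_geometric)
    qed (use assms in auto)
    finally show ?thesis by simp
  qed
  then show "\<forall>\<^sub>F F in finite_subsets_at_top (A \<rightarrow>\<^sub>E (UNIV :: nat set)). (\<Sum>n\<in>F. x ^ (\<Sum>i\<in>A. n i)) \<le> (1 / (1 - x)) ^ card A"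
    by (intro eventually_finite_subsets_at_top_weakI) auto
qed

section \<open>Equality of the two product forms\<close>

lemma qpoch_inf_mult_minus:
  assumes "norm q < 1"
  shows "qpoch_inf a q * qpoch_inf (- a) q = qpoch_inf (a\<^sup>2) (q\<^sup>2)"
proof -
  have "(\<lambda>n. qpoch a q n * qpoch (- a) q n) = qpoch (a\<^sup>2) (q\<^sup>2)"
    unfolding qpoch_def prod.distrib[symmetric]
    by (intro ext prod.cong refl) (simp add: algebra_simps power2_eq_square power_mult_distrib)
  moreover have "(\<lambda>n. qpoch a q n * qpoch (- a) q n) \<longlonglongrightarrow> qpoch_inf a q * qpoch_inf (- a) q"
    by (intro tendsto_mult qpoch_tendsto assms)
  moreover have "qpoch (a\<^sup>2) (q\<^sup>2) \<longlonglongrightarrow> qpoch_inf (a\<^sup>2) (q\<^sup>2)"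
    using qpoch_tendsto[of "q\<^sup>2" "a\<^sup>2"] assms by (simp add: norm_power power_less_one_iff)
  ultimately show ?thesis by (metis LIMSEQ_unique)
qed

lemma qpoch_inf_even_odd:
  assumes "norm q < 1"
  shows "qpoch_inf a q = qpoch_inf a (q\<^sup>2) * qpoch_inf (a * q) (q\<^sup>2)"
proof -
  have q2: "norm (q\<^sup>2) < 1" using assms by (simp add: norm_power power_less_one_iff)
  have "qpoch a q (2 * n) = qpoch a (q\<^sup>2) n * qpoch (a * q) (q\<^sup>2) n" for n
    by (induction n) (simp_all add: qpoch_Suc power_mult[symmetric] mult_ac)
  moreover have "filterlim (\<lambda>n::nat. 2 * n) at_top sequentially"
    by (simp add: mult_nat_left_at_top)
  from filterlim_compose[OF qpoch_tendsto[OF assms] this]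
  have "(\<lambda>n. qpoch a q (2 * n)) \<longlonglongrightarrow> qpoch_inf a q" .
  moreover have "(\<lambda>n. qpoch a (q\<^sup>2) n * qpoch (a * q) (q\<^sup>2) n) \<longlonglongrightarrow> qpoch_inf a (q\<^sup>2) * qpoch_inf (a * q) (q\<^sup>2)"
    by (intro tendsto_mult qpoch_tendsto q2)
  ultimately show ?thesis by (simp add: LIMSEQ_unique)
qed

text \<open>Split \<open>(q;q)\<close> by parity into \<open>(q;q\<^sup>2)\<close> and
  \<open>(q\<^sup>2;q\<^sup>2)\<close>, and merge \<open>(q;q\<^sup>2)\<close> with
  \<open>(-q;q\<^sup>2)\<close> into \<open>(q\<^sup>2;q\<^sup>4)\<close>. Cancelling is legitimate
  because \<open>(q;q)\<close> is nonzero, and with it its factor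
  \<open>(q;q\<^sup>2)\<close>.\<close>

lemma qpoch_inf_quotient:
  assumes "norm q < 1"
  shows "qpoch_inf (- q) (q\<^sup>2) / qpoch_inf (q\<^sup>2) (q\<^sup>2) = qpoch_inf (q\<^sup>2) (q ^ 4) / qpoch_inf q q"
proof -
  have q2: "norm (q\<^sup>2) < 1" using assms by (simp add: norm_power power_less_one_iff)
  have "qpoch_inf q q = qpoch_inf q (q\<^sup>2) * qpoch_inf (q\<^sup>2) (q\<^sup>2)"
    using qpoch_inf_even_odd[OF assms, of q] by (simp add: power2_eq_square)
  moreover have "qpoch_inf q (q\<^sup>2) * qpoch_inf (- q) (q\<^sup>2) = qpoch_inf (q\<^sup>2) (q ^ 4)"
    using qpoch_inf_mult_minus[OF q2, of q] by simp
  ultimately show ?thesis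
    using qpoch_inf_q_nonzero[OF assms] qpoch_inf_q_nonzero[OF q2]
    by (auto simp: field_simps)
qed

section \<open>The multisum\<close>

text \<open>With \<open>j > 1\<close> the variables \<open>n 1, \<dots>, n (j - 1)\<close> are dropped, which makes a downward
  induction on \<open>j\<close> possible.\<close>

definition summand :: "complex \<Rightarrow> nat \<Rightarrow> nat \<Rightarrow> (nat \<Rightarrow> nat) \<Rightarrow> complex" where
  "summand q k j n = q ^ ((\<Sum>i=j..k. (tail_sum k n i)\<^sup>2) + 2 * tail_sum k n k) * qpoch (- q) (q\<^sup>2) (n k)
             / ((\<Prod>i=j..<k. qpoch (q\<^sup>2) (q\<^sup>2) (n i)) * qpoch (q ^ 4) (q ^ 4) (n k))"

lemma tail_sum_rec: "j \<le> k \<Longrightarrow> tail_sum k n j = n j + tail_sum k n (Suc j)"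
  by (simp add: tail_sum_def sum.atLeast_Suc_atMost)

lemma tail_sum_self [simp]: "tail_sum k n k = n k"
  by (simp add: tail_sum_def)

lemma tail_sum_upd: "j < i \<Longrightarrow> tail_sum k (n(j := y)) i = tail_sum k n i"
  unfolding tail_sum_def by (rule sum.cong) auto

lemma le_tail_sum: "i \<in> {j..k} \<Longrightarrow> n i \<le> tail_sum k n j"
  unfolding tail_sum_def by (rule member_le_sum) auto

text \<open>Separates off the variable \<open>n j\<close>: among the tail sums from \<open>j\<close>
  on, only the one at \<open>j\<close> depends on it.\<close>

lemma summand_upd:
  assumes "j < k"
  shows "summand q k j (n(j := y)) = inv_qfact (q\<^sup>2) (int y) * q ^ (y + tail_sum k n (Suc j))\<^sup>2 * summand q k (Suc j) n"
proof -
  have "(\<Sum>i=j..k. (tail_sum k (n(j := y)) i)\<^sup>2)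
      = (y + tail_sum k n (Suc j))\<^sup>2 + (\<Sum>i=Suc j..k. (tail_sum k n i)\<^sup>2)"
    using assms by (simp add: sum.atLeast_Suc_atMost tail_sum_rec[of j] tail_sum_upd cong: sum.cong_simp)
  moreover have "(\<Prod>i=j..<k. qpoch (q\<^sup>2) (q\<^sup>2) ((n(j := y)) i))
      = qpoch (q\<^sup>2) (q\<^sup>2) y * (\<Prod>i=Suc j..<k. qpoch (q\<^sup>2) (q\<^sup>2) (n i))"
    using assms by (simp add: prod.atLeast_Suc_lessThan cong: prod.cong_simp)
  ultimately show ?thesis
    using assms by (simp add: summand_def inv_qfact_of_nat power_add mult.assoc)
qed

lemma sum_PiE_insert:
  assumes "x \<notin> A"
  shows "(\<Sum>n\<in>PiE (insert x A) B. F n) = (\<Sum>g\<in>PiE A B. \<Sum>y\<in>B x. F (g(x := y)))"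
proof -
  have "(\<Sum>n\<in>PiE (insert x A) B. F n) = (\<Sum>(y, g)\<in>B x \<times> PiE A B. F (g(x := y)))"
    unfolding PiE_insert_eq using inj_combinator[OF assms, of B]
    by (subst sum.reindex) (auto simp: case_prod_unfold)
  also have "\<dots> = (\<Sum>y\<in>B x. \<Sum>g\<in>PiE A B. F (g(x := y)))"
    by (rule sum.cartesian_product[symmetric])
  finally show ?thesis by (simp only: sum.swap[of _ "PiE A B"])
qed

text \<open>Summing over the variable \<open>n j\<close>, with \<open>r\<close> its tail sum, is one
  step of the chain. The box \<open>B\<close> stays fixed while the induction hypothesis is used at
  every \<open>r \<le> L\<close>; entries above \<open>L\<close> contribute zero.\<close>

lemma sum_summand_eq_bailey_chain:
  assumes "j \<le> k" "L \<le> B"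
  shows "(\<Sum>n\<in>{j..k} \<rightarrow>\<^sub>E {..B}. summand q k j n * inv_qfact (q\<^sup>2) (int L - int (tail_sum k n j)))
           = bailey_chain q (Suc (k - j)) L"
  using assms
proof (induction j arbitrary: L rule: inc_induct)
  case base
  \<comment> \<open>The extra \<open>2 * tail_sum k n k\<close> in the exponent is the power
    \<open>q ^ (2 * r)\<close> in \<open>bailey_chain q 0 r\<close>.\<close>
  have "(\<Sum>n\<in>{k..k} \<rightarrow>\<^sub>E {..B}. summand q k k n * inv_qfact (q\<^sup>2) (int L - int (tail_sum k n k)))
     = (\<Sum>r\<le>B. inv_qfact (q\<^sup>2) (int L - int r) * q ^ r\<^sup>2 * bailey_chain q 0 r)"
    by (simp add: sum_PiE_insert[of k "{}"] summand_def power_add mult_ac)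
  also have "\<dots> = (\<Sum>r\<le>L. inv_qfact (q\<^sup>2) (int L - int r) * q ^ r\<^sup>2 * bailey_chain q 0 r)"
    using base by (intro sum.mono_neutral_right) auto
  finally show ?case by simp
next
  case (step j)
  let ?R = "inv_qfact (q\<^sup>2)"
  have ins: "{j..k} = insert j {Suc j..k}" using step.hyps by auto
  \<comment> \<open>Substitute \<open>r = y + N\<close>, where \<open>N\<close> will be the tail sum
    at \<open>Suc j\<close>; reciprocals at negative arguments absorb the change of range.\<close>
  have inner: "(\<Sum>y\<le>B. ?R (int y) * q ^ (y + N)\<^sup>2 * ?R (int L - int (y + N)))
      = (\<Sum>r\<le>L. ?R (int r - int N) * q ^ r\<^sup>2 * ?R (int L - int r))" for N
  proof -
    have "(\<Sum>y\<le>B. ?R (int y) * q ^ (y + N)\<^sup>2 * ?R (int L - int (y + N)))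
       = (\<Sum>y\<in>{y. y + N \<le> L}. ?R (int y) * q ^ (y + N)\<^sup>2 * ?R (int L - int (y + N)))"
      using step.prems by (intro sum.mono_neutral_right) auto
    also have "\<dots> = (\<Sum>r\<in>{N..L}. ?R (int r - int N) * q ^ r\<^sup>2 * ?R (int L - int r))"
      by (rule sum.reindex_bij_witness[of _ "\<lambda>r. r - N" "\<lambda>y. y + N"]) auto
    also have "\<dots> = (\<Sum>r\<le>L. ?R (int r - int N) * q ^ r\<^sup>2 * ?R (int L - int r))"
      by (rule sum.mono_neutral_left) auto
    finally show ?thesis .
  qed
  have "(\<Sum>n\<in>{j..k} \<rightarrow>\<^sub>E {..B}. summand q k j n * ?R (int L - int (tail_sum k n j)))
     = (\<Sum>g\<in>{Suc j..k} \<rightarrow>\<^sub>E {..B}. \<Sum>y\<le>B. summand q k (Suc j) g *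
          (?R (int y) * q ^ (y + tail_sum k g (Suc j))\<^sup>2 * ?R (int L - int (y + tail_sum k g (Suc j)))))"
    using step.hyps unfolding ins
    by (simp add: sum_PiE_insert summand_upd tail_sum_rec[of j] tail_sum_upd mult_ac)
  also have "\<dots> = (\<Sum>g\<in>{Suc j..k} \<rightarrow>\<^sub>E {..B}. summand q k (Suc j) g *
      (\<Sum>r\<le>L. ?R (int r - int (tail_sum k g (Suc j))) * q ^ r\<^sup>2 * ?R (int L - int r)))"
    by (simp only: sum_distrib_left[symmetric] inner)
  also have "\<dots> = (\<Sum>r\<le>L. ?R (int L - int r) * q ^ r\<^sup>2 *
      (\<Sum>g\<in>{Suc j..k} \<rightarrow>\<^sub>E {..B}. summand q k (Suc j) g * ?R (int r - int (tail_sum k g (Suc j)))))"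
    unfolding sum_distrib_left by (subst sum.swap) (simp only: mult_ac)
  also have "\<dots> = (\<Sum>r\<le>L. ?R (int L - int r) * q ^ r\<^sup>2 * bailey_chain q (Suc (k - Suc j)) r)"
    using step.prems step.IH by (intro sum.cong refl) auto
  also have "\<dots> = bailey_chain q (Suc (k - j)) L"
    using step.hyps by (simp only: bailey_chain.simps(2)[symmetric] Suc_diff_Suc)
  finally show ?case .
qed

section \<open>Domination of the multisum and of the theta series\<close>

text \<open>Since each squared tail sum is at least \<open>n i\<close>, the power of
  \<open>q\<close> is dominated by a product of geometric terms; the remaining factors are uniformly
  bounded.\<close>

lemma summand_bound:
  assumes q: "norm q < 1"
  obtains C where "C \<ge> 0"
    "\<And>n. norm (summand q k 1 n) \<le> C * norm q ^ (\<Sum>i=1..k. n i)"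
proof -
  have q2: "norm (q\<^sup>2) < 1" and q4: "norm (q ^ 4) < 1"
    using q by (simp_all add: norm_power power_less_one_iff)
  obtain C1 where C1: "\<And>n. norm (qpoch (- q) (q\<^sup>2) n) \<le> C1"
    using qpoch_bounded[OF q2] by blast
  obtain C2 where C2: "C2 > 0" "\<And>n. norm (inv_qfact (q\<^sup>2) n) \<le> C2"
    using inv_qfact_bounded[OF q2] by blast
  obtain C3 where C3: "C3 > 0" "\<And>n. norm (inv_qfact (q ^ 4) n) \<le> C3"
    using inv_qfact_bounded[OF q4] by blast
  have "C1 \<ge> 0" using C1[of 0] norm_ge_zero order_trans by blast
  show ?thesis
  proof (rule that)
    show "0 \<le> C1 * (C2 ^ (k - 1) * C3)"
      using \<open>C1 \<ge> 0\<close> C2 C3 by simp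
    fix n
    define e where "e = (\<Sum>i=1..k. (tail_sum k n i)\<^sup>2) + 2 * tail_sum k n k"
    have "(\<Sum>i=1..k. n i) \<le> (\<Sum>i=1..k. (tail_sum k n i)\<^sup>2)"
    proof (rule sum_mono)
      fix i assume "i \<in> {1..k}"
      then have "n i \<le> tail_sum k n i" by (intro le_tail_sum) auto
      also have "\<dots> \<le> (tail_sum k n i)\<^sup>2" by (simp add: power2_eq_square)
      finally show "n i \<le> (tail_sum k n i)\<^sup>2" .
    qed
    then have e: "norm q ^ e \<le> norm q ^ (\<Sum>i=1..k. n i)"
      using q by (intro power_decreasing) (auto simp: e_def)
    have "summand q k 1 n = q ^ e * (qpoch (- q) (q\<^sup>2) (n k)
         * ((\<Prod>i=1..<k. inv_qfact (q\<^sup>2) (int (n i))) * inv_qfact (q ^ 4) (int (n k))))"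
      by (simp add: summand_def e_def inv_qfact_of_nat prod_dividef)
    then have "norm (summand q k 1 n) = norm q ^ e * (norm (qpoch (- q) (q\<^sup>2) (n k))
         * ((\<Prod>i=1..<k. norm (inv_qfact (q\<^sup>2) (int (n i)))) * norm (inv_qfact (q ^ 4) (int (n k)))))"
      by (simp add: norm_mult norm_power prod_norm)
    also have "\<dots> \<le> norm q ^ (\<Sum>i=1..k. n i) * (C1 * ((\<Prod>i=1..<k. C2) * C3))"
      using e C1 C2 C3 \<open>C1 \<ge> 0\<close>
      by (intro mult_mono prod_mono mult_nonneg_nonneg prod_nonneg) auto
    finally show "norm (summand q k 1 n) \<le> C1 * (C2 ^ (k - 1) * C3) * norm q ^ (\<Sum>i=1..k. n i)"
      by (simp add: mult_ac)
  qed
qed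

text \<open>From \<open>3 * r\<^sup>2 - 2 * r \<ge> \<bar>r\<bar>\<close>; it bounds the theta
  series by a two-sided geometric series.\<close>

lemma theta_exponent_ge:
  fixes r :: int
  assumes "k \<ge> 1"
  shows "(int k + 2) * r\<^sup>2 - 2 * r \<ge> \<bar>r\<bar>"
proof -
  have "3 * r\<^sup>2 \<le> (int k + 2) * r\<^sup>2"
    using assms by (intro mult_right_mono) auto
  moreover have "\<bar>r\<bar> * 1 \<le> \<bar>r\<bar> * \<bar>r\<bar>"
    by (cases "r = 0") (simp, intro mult_left_mono, auto)
  then have "\<bar>r\<bar> \<le> r\<^sup>2"
    by (simp add: power2_eq_square)
  ultimately show ?thesis by linarith
qed

section \<open>Passage to the limit\<close>

text \<open>The limit of \<open>bailey_chain q k\<close> is computed twice, from the multisum and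
  from the Bailey sum; the two values agree.\<close>

lemma has_sum_summand:
  assumes k: "k \<ge> 1" and q: "norm q < 1" "q \<noteq> 0"
  shows "(summand q k 1 has_sum (qpoch_inf (- q) (q\<^sup>2) / qpoch_inf (q\<^sup>2) (q\<^sup>2)
             * qpoch_inf_list [q ^ (2 * k + 4), q ^ k, q ^ (k + 4)] (q ^ (2 * k + 4))))
          ({1..k} \<rightarrow>\<^sub>E (UNIV :: nat set))"
proof -
  let ?X = "{1..k} \<rightarrow>\<^sub>E (UNIV :: nat set)"
  define Q where "Q = qpoch_inf (q\<^sup>2) (q\<^sup>2)"
  define \<alpha> where "\<alpha> r = (-1) powi r * q powi ((int k + 2) * r\<^sup>2 - 2 * r)" for r
  define p where "p = q ^ (2 * k + 4)"
  have q2: "norm (q\<^sup>2) < 1" using q by (simp add: norm_power power_less_one_iff)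
  have Q: "Q \<noteq> 0" unfolding Q_def by (rule qpoch_inf_q_nonzero[OF q2])
  have p: "norm p < 1" "p \<noteq> 0" using q by (simp_all add: p_def norm_power power_less_one_iff)

  \<comment> \<open>The exponent \<open>(k + 2) * r\<^sup>2 - 2 * r\<close> equals
    \<open>k * r + (2 * k + 4) * (r * (r - 1) / 2)\<close>. Thus the triple product applies with
    \<open>z = q ^ k\<close>, and \<open>p / z = q ^ (k + 4)\<close>.\<close>
  have \<alpha>_eq: "\<alpha> r = (-1) powi r * (q ^ k) powi r * p powi (r * (r - 1) div 2)" for r
  proof -
    have "even (r * (r - 1))" by simp
    then have h: "2 * (r * (r - 1) div 2) = r * (r - 1)"
      by (rule dvd_mult_div_cancel)
    have "int (2 * k + 4) * t = (int k + 2) * (2 * t)" for t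
      by (simp add: algebra_simps)
    then have "int (2 * k + 4) * (r * (r - 1) div 2) = (int k + 2) * (2 * (r * (r - 1) div 2))" .
    also have "int k * r + \<dots> = (int k + 2) * r\<^sup>2 - 2 * r"
      unfolding h by (simp add: algebra_simps power2_eq_square)
    finally have e: "int k * r + int (2 * k + 4) * (r * (r - 1) div 2) = (int k + 2) * r\<^sup>2 - 2 * r" .
    show ?thesis
      unfolding \<alpha>_def p_def power_int_power mult.assoc e[symmetric] power_int_add[OF disjI1[OF q(2)]] ..
  qed
  have \<alpha>_summable: "(\<lambda>r. norm (\<alpha> r)) summable_on UNIV"
  proof (rule Infinite_Sum.abs_summable_on_comparison_test')
    show "(\<lambda>r::int. norm q ^ nat \<bar>r\<bar>) summable_on UNIV"
      using q by (intro summable_on_power_abs_int) auto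
    fix r :: int
    have "norm (\<alpha> r) = norm q powi ((int k + 2) * r\<^sup>2 - 2 * r)"
      by (simp add: \<alpha>_def norm_mult norm_power_int)
    also have "\<dots> \<le> norm q powi \<bar>r\<bar>"
      using q theta_exponent_ge[OF k, of r] by (intro power_int_decreasing) auto
    also have "\<dots> = norm q ^ nat \<bar>r\<bar>" by (simp add: power_int_def)
    finally show "norm (\<alpha> r) \<le> norm q ^ nat \<bar>r\<bar>" .
  qed
  have theta: "infsum \<alpha> UNIV = qpoch_inf_list [p, q ^ k, q ^ (k + 4)] p"
  proof -
    have "2 * k + 4 = (k + 4) + k" by simp
    then have "p = q ^ (k + 4) * q ^ k"
      by (simp only: p_def power_add)
    then have "p / q ^ k = q ^ (k + 4)" using q by simp
    then show ?thesis
      using jacobi_triple_product[OF p, of "q ^ k"] q \<alpha>_summable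
      unfolding \<alpha>_eq[abs_def] by (simp add: qpoch_inf_list_def mult.assoc)
  qed

  obtain C where C: "C \<ge> 0" "\<And>n. norm (summand q k 1 n) \<le> C * norm q ^ (\<Sum>i=1..k. n i)"
    using summand_bound[OF q(1)] by blast
  obtain D where D: "D > 0" "\<And>n. norm (inv_qfact (q\<^sup>2) n) \<le> D"
    using inv_qfact_bounded[OF q2] by blast
  have geo: "(\<lambda>n. norm q ^ (\<Sum>i=1..k. n i)) summable_on ?X"
    using q by (intro summable_on_PiE_power) auto
  have "(\<lambda>n. norm (summand q k 1 n)) summable_on ?X"
    using summable_on_cmult_right[OF geo] C(2) by (rule Infinite_Sum.abs_summable_on_comparison_test')
  then have summable: "summand q k 1 summable_on ?X"
    by (rule abs_summable_summable)

  \<comment> \<open>The weight vanishes unless the full tail sum is at most \<open>L\<close>, so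
    \<open>infsum (f L)\<close> is a finite sum; for fixed \<open>n\<close> the weight tends to
    \<open>1 / Q\<close>.\<close>
  define f where "f L n = summand q k 1 n * inv_qfact (q\<^sup>2) (int L - int (tail_sum k n 1))" for L n
  have f_inf: "infsum (f L) ?X = bailey_chain q k L" for L
  proof -
    have "infsum (f L) ?X = infsum (f L) ({1..k} \<rightarrow>\<^sub>E {..L})"
    proof (rule infsum_cong_neutral)
      fix n assume "n \<in> ?X - ({1..k} \<rightarrow>\<^sub>E {..L})"
      then obtain i where "i \<in> {1..k}" "n i > L" by (auto simp: PiE_iff not_le)
      then have "tail_sum k n 1 > L" using le_tail_sum[of i 1 k n] by linarith
      then show "f L n = 0" by (simp add: f_def)
    qed (auto simp: PiE_iff)
    also have "\<dots> = (\<Sum>n\<in>{1..k} \<rightarrow>\<^sub>E {..L}. f L n)"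
      by (intro infsum_finite finite_PiE) auto
    also have "\<dots> = bailey_chain q k L"
      using sum_summand_eq_bailey_chain[OF k order_refl, of q L] k by (simp add: f_def)
    finally show ?thesis .
  qed
  have "(\<lambda>L. infsum (f L) ?X) \<longlonglongrightarrow> infsum (\<lambda>n. summand q k 1 n * (1 / Q)) ?X"
  proof (rule tannery_infsum)
    show "norm (f L n) \<le> C * norm q ^ (\<Sum>i=1..k. n i) * D" for L n
      unfolding f_def norm_mult using C D by (intro mult_mono) auto
    show "(\<lambda>n. C * norm q ^ (\<Sum>i=1..k. n i) * D) summable_on ?X"
      using geo by (intro summable_on_cmult_left summable_on_cmult_right)
    show "(\<lambda>L. f L n) \<longlonglongrightarrow> summand q k 1 n * (1 / Q)" for n
      unfolding f_def Q_def
      using inv_qfact_tendsto[OF q2, of "- int (tail_sum k n 1)"]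
      by (intro tendsto_mult tendsto_const) simp
  qed
  then have "bailey_chain q k \<longlonglongrightarrow> infsum (summand q k 1) ?X / Q"
    unfolding f_inf infsum_cmult_left' by simp
  moreover have "bailey_chain q k \<longlonglongrightarrow> qpoch_inf (- q) (q\<^sup>2) * (infsum \<alpha> UNIV / Q\<^sup>2)"
    unfolding bailey_chain_eq[OF q, abs_def] \<alpha>_def[symmetric] Q_def
    by (intro tendsto_mult qpoch_tendsto bailey_sum_tendsto q2 \<alpha>_summable)
  ultimately have "infsum (summand q k 1) ?X / Q = qpoch_inf (- q) (q\<^sup>2) * (infsum \<alpha> UNIV / Q\<^sup>2)"
    by (rule LIMSEQ_unique)
  then have "infsum (summand q k 1) ?X = qpoch_inf (- q) (q\<^sup>2) / Q * qpoch_inf_list [p, q ^ k, q ^ (k + 4)] p"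
    using Q unfolding theta by (simp add: field_simps power2_eq_square)
  then show ?thesis
    using summable unfolding Q_def p_def by (metis has_sum_infsum)
qed

section \<open>The case of vanishing \<open>q\<close>\<close>

lemma qpoch_inf_0_0: "qpoch_inf 0 0 = 1"
  by (simp add: qpoch_inf_def)

text \<open>Treated apart because the theta argument divides by powers of \<open>q\<close>. Only the
  zero tuple has exponent zero, and \<open>0 ^ 0 = 1\<close>.\<close>

lemma has_sum_summand_0:
  assumes k: "k \<ge> 1"
  shows "(summand 0 k 1 has_sum 1) ({1..k} \<rightarrow>\<^sub>E (UNIV :: nat set))"
proof -
  let ?X = "{1..k} \<rightarrow>\<^sub>E (UNIV :: nat set)"
  \<comment> \<open>The restriction makes the zero tuple extensional, as membership in
    \<open>?X\<close> demands.\<close>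
  define z where "z = restrict (\<lambda>_. 0 :: nat) {1..k}"
  have "summand 0 k 1 n = 0" if "n \<in> ?X" "n \<noteq> z" for n
  proof -
    have "\<exists>i\<in>{1..k}. n i \<noteq> 0"
    proof (rule ccontr)
      assume "\<not> ?thesis"
      then have "n = z" using that(1) by (auto simp: z_def PiE_iff extensional_def restrict_def fun_eq_iff)
      with that(2) show False by simp
    qed
    then obtain i where i: "i \<in> {1..k}" "n i \<noteq> 0" by blast
    then have "tail_sum k n i \<noteq> 0" using le_tail_sum[of i i k n] by auto
    with i have "(\<Sum>i=1..k. (tail_sum k n i)\<^sup>2) \<noteq> 0" by (auto simp: sum_eq_0_iff)
    then have "(0 :: complex) ^ ((\<Sum>i=1..k. (tail_sum k n i)\<^sup>2) + 2 * tail_sum k n k) = 0"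
      by (simp only: power_0_left add_is_0 if_False simp_thms)
    then show ?thesis unfolding summand_def by (simp only: mult_zero_left div_0)
  qed
  moreover have "tail_sum k z i = 0" if "i \<ge> 1" for i
    using that by (auto simp: tail_sum_def z_def)
  then have "summand 0 k 1 z = 1"
    using k by (simp add: summand_def z_def)
  ultimately have "(summand 0 k 1 has_sum 1) ?X \<longleftrightarrow> (summand 0 k 1 has_sum 1) {z}"
    by (intro has_sum_cong_neutral) (auto simp: z_def)
  then show ?thesis
    using \<open>summand 0 k 1 z = 1\<close> has_sum_finite[of "{z}" "summand 0 k 1"] by simp
qed

theorem mainTheorem3:
  fixes k :: nat and q :: complex
  assumes "k \<ge> 1" and "norm q < 1"
  shows "((\<lambda>n. q ^ ((\<Sum>i=1..k. (tail_sum k n i)\<^sup>2) + 2 * tail_sum k n k) * qpoch (- q) (q ^ 2) (n k)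
             / ((\<Prod>i=1..<k. qpoch (q ^ 2) (q ^ 2) (n i)) * qpoch (q ^ 4) (q ^ 4) (n k)))
          has_sum (qpoch_inf (- q) (q ^ 2) / qpoch_inf (q ^ 2) (q ^ 2)
             * qpoch_inf_list [q ^ (2 * k + 4), q ^ k, q ^ (k + 4)] (q ^ (2 * k + 4))))
          ({1..k} \<rightarrow>\<^sub>E (UNIV :: nat set))
       \<and> qpoch_inf (- q) (q ^ 2) / qpoch_inf (q ^ 2) (q ^ 2)
             * qpoch_inf_list [q ^ (2 * k + 4), q ^ k, q ^ (k + 4)] (q ^ (2 * k + 4))
         = qpoch_inf (q ^ 2) (q ^ 4) / qpoch_inf q q
             * qpoch_inf_list [q ^ (2 * k + 4), q ^ k, q ^ (k + 4)] (q ^ (2 * k + 4))"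
proof -
  have "(summand q k 1 has_sum (qpoch_inf (- q) (q\<^sup>2) / qpoch_inf (q\<^sup>2) (q\<^sup>2)
             * qpoch_inf_list [q ^ (2 * k + 4), q ^ k, q ^ (k + 4)] (q ^ (2 * k + 4))))
          ({1..k} \<rightarrow>\<^sub>E (UNIV :: nat set))"
  proof (cases "q = 0")
    case True
    \<comment> \<open>As \<open>k \<ge> 1\<close>, every argument and base on the product side is
      \<open>0\<close>, so that side equals \<open>1\<close>.\<close>
    then show ?thesis
      using has_sum_summand_0[OF assms(1)] assms(1)
      by (simp add: qpoch_inf_list_def qpoch_inf_0_0 power_0_left)
  next
    case False
    with assms show ?thesis by (intro has_sum_summand)
  qed
  then show ?thesis
    unfolding summand_def[abs_def] using qpoch_inf_quotient[OF assms(2)] by simp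
qed

end
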